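(* Let $(G_n,C_n)_{n\in\mathbb{N}_0}$ be an i.i.d. sequence of pairs of non-negative real random variables, let $F_C$ be the cumulative distribution function of $C_0$, and for $z\in\mathbb{R}$ let $Z_0=z$, $Z_{n+1}=Z_n+G_n-C_n$ (the Cramer–Lundberg model), with probability $\mathsf{P}_z$. Define the ruin probability $\psi(z)=\mathsf{P}_z\{\inf_{n\in\mathbb{N}_0}Z_n<0\}$ and, for $y>0$, the two-barrier probability $$\phi(z,y)=\mathsf{P}_z\{\tau_{(y,\infty)}<\tau_{(-\infty,0)},\ \tau_{(y,\infty)}<\infty\},$$ where $\tau_S=\inf\{n\in\mathbb{N}_0: Z_n\in S\}$ (with $\inf\emptyset=\infty$). Assume: (1) $a:=\mathsf{E}G_0-\mathsf{E}C_0>0$; (2) $F_C(x)<1$ for all $x>0$; (3) $\mathsf{E}|C_0-G_0|^\gamma<\infty$ for some $\gamma\ge 2$. Let $s_1$ be any real number with $\mathsf{E}\min(G_0-C_0,s_1)\ge\frac23 a$, let $s_2=2^{\gamma-1}\frac{\gamma-1}{a}\mathsf{E}(G_0-C_0)^2$, $s_3=\max(s_1,s_2)$, $$c_1=\gamma(\gamma-1)2^{\gamma-3}\,\mathsf{E}\big[C_0^{\gamma-2}(G_0-C_0)^2\big],\qquad c_2=\gamma\,\mathsf{E}\big[(s_3+C_0)^{\gamma-1}C_0\big],$$ and $c=\frac{3\max(c_1,c_2)}{a\gamma}+\frac12 s_3^{\gamma-1}$. Then for all $z>0$ and $y>0$, $$|\psi(z)-(1-\phi(z,y))|\le c\,y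^{1-\gamma}.$$
   Context: $\mathbb{N}_0=\{0,1,2,\dots\}$. $\phi(z,y)$ is the probability that the process $Z$ started at $z$ exceeds the level $y$ strictly before it first becomes negative. *)

theory Defs
  imports "HOL-Probability.Probability"
begin

definition hit_time :: "real set \<Rightarrow> (nat \<Rightarrow> real) \<Rightarrow> enat" where
  "hit_time S X = (if \<exists>n. X n \<in> S then enat (LEAST n. X n \<in> S) else \<infinity>)"

definition CL_proc :: "(nat \<Rightarrow> 'a \<Rightarrow> real) \<Rightarrow> (nat \<Rightarrow> 'a \<Rightarrow> real) \<Rightarrow> real \<Rightarrow> 'a \<Rightarrow> nat \<Rightarrow> real" where
  "CL_proc G C z \<omega> n = z + (\<Sum>k<n. G k \<omega> - C k \<omega>)"

end

theory Submission
  imports Defs "HOL-Real_Asymp.Real_Asymp"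
begin

text \<open>
  Let \<open>W\<^sub>0 = 0\<close> and \<open>W\<^sub>N\<^sub>+\<^sub>1 = max 0 (W\<^sub>N - (G - C))\<close> with a fresh pair \<open>(G, C)\<close>; in law, \<open>W\<^sub>N\<close> is the largest
  loss of the walk within \<open>N\<close> steps, hence stochastically increasing in \<open>N\<close>. Since the drift is positive,
  the walk almost surely leaves \<open>[0, y]\<close>, so \<open>\<psi> - (1 - \<phi>)\<close> is the probability of ruin after exceeding \<open>y\<close>.
  This forces the walk restarted at the passage time to lose more than \<open>y\<close>, whence
  \<open>0 \<le> \<psi> - (1 - \<phi>) \<le> sup\<^sub>N P(W\<^sub>N > y)\<close>. A drift condition \<open>E V(W\<^sub>N\<^sub>+\<^sub>1) + \<kappa> P(W\<^sub>N > y) \<le> E V(W\<^sub>N) + m\<close>,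
  summed over \<open>N\<close>, gives \<open>\<kappa> P(W\<^sub>N > y) \<le> m\<close> by monotonicity.
  For \<open>y \<ge> s\<^sub>3\<close> take \<open>V w = w powr \<gamma>\<close>, expanded to second order; for \<open>y < s\<^sub>3\<close> take \<open>V w = w\<close>. Both yield
  \<open>P(W\<^sub>N > y) \<le> 3 max(c\<^sub>1, c\<^sub>2) / (a\<gamma>) y powr (1 - \<gamma>)\<close>.
\<close>

subsection \<open>One-step bounds for power functions\<close>

text \<open>Taylor's formula at \<open>w\<close> with Lagrange remainder: the intermediate point is
  at most \<open>R\<close>, and the second derivative is increasing because \<gamma> \<ge> 2. The
  endpoint \<open>u = 0\<close> is treated by hand, as the differentiation rule needs a positive
  base.\<close>

lemma powr_quadratic_upper_bound:
  fixes \<gamma> u w R :: real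
  assumes "2 \<le> \<gamma>" "0 < w" "w \<le> R" "0 \<le> u" "u \<le> R"
  shows "u powr \<gamma> \<le> w powr \<gamma> + \<gamma> * w powr (\<gamma> - 1) * (u - w)
           + \<gamma> * (\<gamma> - 1) / 2 * R powr (\<gamma> - 2) * (u - w)\<^sup>2"
proof (cases "u = 0")
  case True
  have "w powr \<gamma> = w powr (\<gamma> - 2) * w\<^sup>2" "w powr \<gamma> = w powr (\<gamma> - 1) * w"
    using assms by (simp_all add: powr_diff power2_eq_square)
  moreover have "w powr (\<gamma> - 2) * w\<^sup>2 \<le> R powr (\<gamma> - 2) * w\<^sup>2"
    using assms by (intro mult_right_mono powr_mono2) auto
  ultimately have "\<gamma> * (\<gamma> - 1) / 2 * (R powr (\<gamma> - 2) * w\<^sup>2) \<ge> \<gamma> * (\<gamma> - 1) / 2 * w powr \<gamma>"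
    using assms by (intro mult_left_mono) auto
  \<comment> \<open>For \<open>R = w\<close> and \<open>u = 0\<close> the right-hand side is
    \<open>w powr \<gamma>\<close> times 1 - \<gamma> + \<gamma> (\<gamma> - 1) / 2; this is the
    factorisation of that number.\<close>
  moreover have "(\<gamma> - 1) * (\<gamma> / 2 - 1) * w powr \<gamma> \<ge> 0"
    using assms by auto
  ultimately show ?thesis
    using True assms \<open>w powr \<gamma> = w powr (\<gamma> - 1) * w\<close> by (simp add: field_simps power2_eq_square)
next
  case False
  with assms have "u > 0" by simp
  show ?thesis
  proof (cases "u = w")
    case False
    define diff where "diff = (\<lambda>n::nat. if n = 0 then (\<lambda>x::real. x powr \<gamma>) else if n = 1 then (\<lambda>x. \<gamma> * x powr (\<gamma> - 1))
        else (\<lambda>x. \<gamma> * (\<gamma> - 1) * x powr (\<gamma> - 2)))"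
    have "\<exists>t. (if u < w then u < t \<and> t < w else w < t \<and> t < u) \<and>
        u powr \<gamma> = (\<Sum>m<2. diff m w / fact m * (u - w) ^ m) + diff 2 t / fact 2 * (u - w) ^ 2"
    proof (rule Taylor[of 2 diff "\<lambda>x. x powr \<gamma>" "min u w" "max u w"])
      show "\<forall>m t. m < 2 \<and> min u w \<le> t \<and> t \<le> max u w \<longrightarrow> (diff m has_real_derivative diff (Suc m) t) (at t)"
      proof (intro allI impI)
        fix m :: nat and t :: real
        assume *: "m < 2 \<and> min u w \<le> t \<and> t \<le> max u w"
        then have "t > 0" using \<open>u > 0\<close> assms by (auto simp: min_def split: if_splits)
        from * have "m = 0 \<or> m = 1" by auto
        then show "(diff m has_real_derivative diff (Suc m) t) (at t)"
          using \<open>t > 0\<close> by (auto simp: diff_def intro!: derivative_eq_intros)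
      qed
    qed (use False in \<open>auto simp: diff_def\<close>)
    then obtain t where between: "if u < w then u < t \<and> t < w else w < t \<and> t < u"
      and eq: "u powr \<gamma> = (\<Sum>m<2. diff m w / fact m * (u - w) ^ m) + diff 2 t / fact 2 * (u - w) ^ 2"
      by blast
    have t: "0 < t" "t \<le> R"
      using between assms \<open>u > 0\<close> by (auto split: if_splits)
    have "t powr (\<gamma> - 2) \<le> R powr (\<gamma> - 2)"
      using t assms by (intro powr_mono2) auto
    then have "\<gamma> * (\<gamma> - 1) / 2 * (t powr (\<gamma> - 2) * (u - w)\<^sup>2) \<le> \<gamma> * (\<gamma> - 1) / 2 * (R powr (\<gamma> - 2) * (u - w)\<^sup>2)"
      using assms by (intro mult_left_mono mult_right_mono) auto
    then show ?thesis
      using eq by (simp add: diff_def numeral_2_eq_2)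
  qed auto
qed

text \<open>Mean value theorem with an increasing derivative. The case \<open>w = 0\<close> stays
  outside the differentiation rule and is a direct comparison.\<close>

lemma powr_increment_le:
  fixes \<gamma> w c :: real
  assumes "1 \<le> \<gamma>" "0 \<le> w" "0 \<le> c"
  shows "(w + c) powr \<gamma> \<le> w powr \<gamma> + \<gamma> * (w + c) powr (\<gamma> - 1) * c"
proof (cases "w = 0 \<or> c = 0")
  case True
  have "c powr \<gamma> = c powr (\<gamma> - 1) * c" if "c \<noteq> 0"
    using assms that by (simp add: powr_diff)
  moreover have "1 * (c powr (\<gamma> - 1) * c) \<le> \<gamma> * (c powr (\<gamma> - 1) * c)"
    using assms by (intro mult_right_mono) auto
  ultimately show ?thesis
    using True assms by (cases "c = 0") (auto simp: algebra_simps)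
next
  case False
  with assms have pos: "w > 0" "c > 0" by auto
  have "\<exists>t. w < t \<and> t < w + c \<and> (w + c) powr \<gamma> - w powr \<gamma> = (w + c - w) * (\<gamma> * t powr (\<gamma> - 1))"
    using pos by (intro MVT2) (auto intro!: derivative_eq_intros)
  then obtain t where t: "w < t" "t < w + c"
    and eq: "(w + c) powr \<gamma> - w powr \<gamma> = c * (\<gamma> * t powr (\<gamma> - 1))" by auto
  have "t powr (\<gamma> - 1) \<le> (w + c) powr (\<gamma> - 1)"
    using t pos assms by (intro powr_mono2) auto
  then have "c * (\<gamma> * t powr (\<gamma> - 1)) \<le> c * (\<gamma> * (w + c) powr (\<gamma> - 1))"
    using pos assms by (intro mult_left_mono) auto
  with eq show ?thesis by (simp add: algebra_simps)
qed

text \<open>The case distinction restores \<open>0\<^sup>0 = 1\<close>, since \<open>0 powr 0 = 0\<close>.\<close>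

lemma powr_add_le:
  fixes p w c :: real
  assumes "0 \<le> p" "0 < w" "0 \<le> c"
  shows "(w + c) powr p \<le> 2 powr p * (w powr p + (if p = 0 then 1 else c powr p))"
proof (cases "c \<le> w")
  case True
  have "(w + c) powr p \<le> (2 * w) powr p"
    using True assms by (intro powr_mono2) auto
  also have "\<dots> = 2 powr p * (w powr p + 0)"
    using assms by (simp add: powr_mult)
  also have "\<dots> \<le> 2 powr p * (w powr p + (if p = 0 then 1 else c powr p))"
    by (intro mult_left_mono add_left_mono) auto
  finally show ?thesis .
next
  case False
  have "(w + c) powr p \<le> (2 * c) powr p"
    using False assms by (intro powr_mono2) auto
  also have "\<dots> = 2 powr p * (0 + c powr p)"
    using assms by (simp add: powr_mult)
  also have "\<dots> \<le> 2 powr p * (w powr p + (if p = 0 then 1 else c powr p))"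
    by (intro mult_left_mono add_mono) (use False assms in auto)
  finally show ?thesis .
qed

text \<open>Replacing the increment by \<open>e = min (g - c) s\<close> only raises the next
  position, and \<open>e \<le> s \<le> w\<close> makes the reflection at 0 disappear. Since
  \<open>w - e \<le> w + c\<close>, the quadratic bound applies with \<open>R = w + c\<close>;
  splitting \<open>(w + c) powr (\<gamma> - 2)\<close> gives one part in \<open>w\<close>, to be
  absorbed by the drift, and one part in \<open>c\<close>, whose mean is the constant c1.\<close>

lemma powr_step_above:
  fixes \<gamma> w s g c :: real
  assumes "2 \<le> \<gamma>" "0 < s" "s \<le> w" "0 \<le> g" "0 \<le> c"
  shows "max 0 (w - (g - c)) powr \<gamma> \<le> w powr \<gamma> - \<gamma> * w powr (\<gamma> - 1) * min (g - c) s
           + \<gamma> * (\<gamma> - 1) * 2 powr (\<gamma> - 3) * w powr (\<gamma> - 2) * (g - c)\<^sup>2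
           + \<gamma> * (\<gamma> - 1) * 2 powr (\<gamma> - 3) * ((if \<gamma> = 2 then 1 else c powr (\<gamma> - 2)) * (g - c)\<^sup>2)"
proof -
  define e where "e = min (g - c) s"
  define q where "q = (if \<gamma> = 2 then 1 else c powr (\<gamma> - 2))"
  have q: "(w + c) powr (\<gamma> - 2) \<le> 2 powr (\<gamma> - 2) * (w powr (\<gamma> - 2) + q)" "q \<ge> 0"
    using powr_add_le[of "\<gamma> - 2" w c] assms by (auto simp: q_def)
  have e2: "e\<^sup>2 \<le> (g - c)\<^sup>2"
    using assms by (auto simp: e_def min_def intro!: power_mono)
  have two: "2 powr (\<gamma> - 2) = 2 * 2 powr (\<gamma> - 3)"
    using powr_add[of 2 1 "\<gamma> - 3"] by simp
  have "max 0 (w - (g - c)) powr \<gamma> \<le> (w - e) powr \<gamma>"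
    using assms by (intro powr_mono2) (auto simp: e_def)
  also have "\<dots> \<le> w powr \<gamma> + \<gamma> * w powr (\<gamma> - 1) * ((w - e) - w)
           + \<gamma> * (\<gamma> - 1) / 2 * (w + c) powr (\<gamma> - 2) * ((w - e) - w)\<^sup>2"
    using assms by (intro powr_quadratic_upper_bound) (auto simp: e_def min_def)
  also have "\<gamma> * (\<gamma> - 1) / 2 * (w + c) powr (\<gamma> - 2) * ((w - e) - w)\<^sup>2
      \<le> \<gamma> * (\<gamma> - 1) / 2 * (2 powr (\<gamma> - 2) * (w powr (\<gamma> - 2) + q)) * (g - c)\<^sup>2"
    using assms q e2 by (intro mult_mono) auto
  finally show ?thesis
    unfolding two e_def[symmetric] q_def[symmetric] by (simp add: field_simps)
qed

text \<open>Gains are discarded, so the next position is at most \<open>w + c\<close>. The error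
  term does not depend on \<open>w\<close>; its mean is the constant c2.\<close>

lemma powr_step_below:
  fixes \<gamma> w s g c :: real
  assumes "2 \<le> \<gamma>" "0 \<le> w" "w \<le> s" "0 \<le> g" "0 \<le> c"
  shows "max 0 (w - (g - c)) powr \<gamma> \<le> w powr \<gamma> + \<gamma> * ((s + c) powr (\<gamma> - 1) * c)"
proof -
  have "max 0 (w - (g - c)) powr \<gamma> \<le> (w + c) powr \<gamma>"
    using assms by (intro powr_mono2) auto
  also have "\<dots> \<le> w powr \<gamma> + \<gamma> * (w + c) powr (\<gamma> - 1) * c"
    using assms by (intro powr_increment_le) auto
  also have "\<gamma> * (w + c) powr (\<gamma> - 1) * c \<le> \<gamma> * (s + c) powr (\<gamma> - 1) * c"
    using assms by (intro mult_right_mono mult_left_mono powr_mono2) auto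
  finally show ?thesis by (simp add: algebra_simps)
qed

subsection \<open>The Lindley recursion of an i.i.d. walk\<close>

text \<open>\<open>drawdown N n x\<close> is the maximum of \<open>- (x\<^sub>n + \<dots> + x\<^sub>n\<^sub>+\<^sub>m\<^sub>-\<^sub>1)\<close> over \<open>m \<le> N\<close>. Recursing on the first step makes
  it both increasing in \<open>N\<close> and a Lindley step applied to an independent variable.\<close>

primrec drawdown :: "nat \<Rightarrow> nat \<Rightarrow> (nat \<Rightarrow> real) \<Rightarrow> real" where
  "drawdown 0 n x = 0"
| "drawdown (Suc N) n x = max 0 (drawdown N (Suc n) x - x n)"

lemma drawdown_nonneg: "0 \<le> drawdown N n x"
  by (cases N) auto

lemma drawdown_le_Suc: "drawdown N n x \<le> drawdown (Suc N) n x"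
proof (induction N arbitrary: n)
  case (Suc N)
  show ?case using Suc[of "Suc n"] by simp
qed simp

lemma drawdown_mono: "N \<le> N' \<Longrightarrow> drawdown N n x \<le> drawdown N' n x"
  by (rule lift_Suc_mono_le[of "\<lambda>N. drawdown N n x"]) (auto intro: drawdown_le_Suc simp del: drawdown.simps)

lemma neg_sum_le_drawdown: "- (\<Sum>k=n..<n+m. x k) \<le> drawdown m n x"
proof (induction m arbitrary: n)
  case (Suc m)
  have "(\<Sum>k=n..<n + Suc m. x k) = x n + (\<Sum>k=Suc n..<Suc n + m. x k)"
    by (subst sum.atLeast_Suc_lessThan) auto
  then show ?case using Suc[of "Suc n"] by simp
qed simp

lemma drawdown_cong: "(\<And>k. n \<le> k \<Longrightarrow> x k = x' k) \<Longrightarrow> drawdown N n x = drawdown N n x'"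
  by (induction N arbitrary: n) auto

text \<open>The index set is left open so that the functional can be read on whole sequences and
  also on restrictions to \<open>{n..}\<close>, the form that independence requires.\<close>

lemma measurable_drawdown:
  "{n..} \<subseteq> A \<Longrightarrow> drawdown N n \<in> borel_measurable (PiM A (\<lambda>_. borel))"
proof (induction N arbitrary: n)
  case (Suc N)
  have *: "{Suc n..} \<subseteq> A" "n \<in> A" using Suc.prems by auto
  note [measurable] = Suc.IH[OF *(1)] measurable_component_singleton[OF *(2), of "\<lambda>_. borel"]
  show ?case by simp
next
  case 0
  have "drawdown 0 n = (\<lambda>_. 0)" by auto
  then show ?case by simp
qed

locale iid_steps = prob_space M for M :: "'a measure" +
  fixes D :: "nat \<Rightarrow> 'a \<Rightarrow> real"
  assumes indep: "indep_vars (\<lambda>_. borel) D UNIV"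
    and ident: "distr M borel (D n) = distr M borel (D 0)"
begin

section \<open>Independence and stationarity of the recursion\<close>

lemma measurable_D [measurable]: "D n \<in> borel_measurable M"
  using indep by (auto simp: indep_vars_def)

abbreviation W :: "nat \<Rightarrow> nat \<Rightarrow> 'a \<Rightarrow> real" where
  "W N n \<omega> \<equiv> drawdown N n (\<lambda>k. D k \<omega>)"

lemma measurable_W [measurable]: "W N n \<in> borel_measurable M"
proof -
  have [measurable]: "drawdown N n \<in> borel_measurable (PiM UNIV (\<lambda>_. borel))"
    by (rule measurable_drawdown) simp
  have [measurable]: "(\<lambda>\<omega> k. D k \<omega>) \<in> M \<rightarrow>\<^sub>M PiM UNIV (\<lambda>_. borel)"
    by (rule measurable_PiM_single') auto
  show ?thesis by measurable
qed

text \<open>Disjoint blocks of coordinates are independent, and \<open>W N n\<close> reads only the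
  block \<open>{n..}\<close>. The case \<open>A = {n}\<close> yields the one-step recursion, the
  case \<open>A = {..<n}\<close> the independence of a passage at time \<open>n\<close> from what
  follows.\<close>

lemma indep_past_W:
  assumes A: "A \<inter> {n..} = {}" and f: "f \<in> borel_measurable (PiM A (\<lambda>_. borel))"
  shows "indep_var borel (\<lambda>\<omega>. f (restrict (\<lambda>k. D k \<omega>) A)) borel (W N n)"
proof -
  have g: "drawdown N n \<in> borel_measurable (PiM {n..} (\<lambda>_. borel))"
    by (rule measurable_drawdown) simp
  have "indep_var borel (f \<circ> (\<lambda>\<omega>. restrict (\<lambda>k. D k \<omega>) A)) borel (drawdown N n \<circ> (\<lambda>\<omega>. restrict (\<lambda>k. D k \<omega>) {n..}))"
    using indep_var_compose[OF indep_var_restrict[OF indep A] f g] by simp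
  also have "drawdown N n \<circ> (\<lambda>\<omega>. restrict (\<lambda>k. D k \<omega>) {n..}) = W N n"
    by (auto simp: fun_eq_iff intro!: drawdown_cong)
  finally show ?thesis unfolding comp_def .
qed

lemma indep_step_W: "indep_var borel (D n) borel (W N (Suc n))"
  using indep_past_W[of "{n}" "Suc n" "\<lambda>x. x n" N] by simp

text \<open>By induction, \<open>W (Suc N) n\<close> is one fixed function of an independent pair
  whose two laws do not depend on \<open>n\<close>.\<close>

lemma distr_W: "distr M borel (W N n) = distr M borel (W N 0)"
proof (induction N arbitrary: n)
  case (Suc N)
  have *: "distr M borel (W (Suc N) n)
      = distr (distr M borel (D 0) \<Otimes>\<^sub>M distr M borel (W N 0)) borel (\<lambda>(d, w). max 0 (w - d))" for n
  proof -
    have "distr M borel (W (Suc N) n)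
        = distr (distr M (borel \<Otimes>\<^sub>M borel) (\<lambda>\<omega>. (D n \<omega>, W N (Suc n) \<omega>))) borel (\<lambda>(d, w). max 0 (w - d))"
      by (subst distr_distr) (auto simp: comp_def)
    also have "distr M (borel \<Otimes>\<^sub>M borel) (\<lambda>\<omega>. (D n \<omega>, W N (Suc n) \<omega>))
        = distr M borel (D n) \<Otimes>\<^sub>M distr M borel (W N (Suc n))"
      using indep_step_W[of n N] by (simp add: indep_var_distribution_eq)
    finally show ?thesis by (simp add: ident[of n] Suc[of "Suc n"])
  qed
  show ?case by (simp only: *)
qed simp

lemma nn_integral_W_cong:
  assumes [measurable]: "f \<in> borel_measurable borel"
  shows "(\<integral>\<^sup>+\<omega>. f (W N n \<omega>) \<partial>M) = (\<integral>\<^sup>+\<omega>. f (W N 0 \<omega>) \<partial>M)"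
  using distr_W[of N n] nn_integral_distr[of "W N n" M borel f] nn_integral_distr[of "W N 0" M borel f]
  by simp

text \<open>The recursion peels off the first step and leaves \<open>W N (Suc 0)\<close>, which is
  independent of that step and has the law of \<open>W N 0\<close>. The inner integral is thus the
  transition kernel of the reflected walk, applied at the state \<open>W N 0\<close>.\<close>

lemma nn_integral_W_Suc:
  assumes [measurable]: "f \<in> borel_measurable borel"
  shows "(\<integral>\<^sup>+\<omega>. f (W (Suc N) 0 \<omega>) \<partial>M) = (\<integral>\<^sup>+\<omega>. (\<integral>\<^sup>+\<omega>'. f (max 0 (W N 0 \<omega> - D 0 \<omega>')) \<partial>M) \<partial>M)"
proof -
  interpret W': prob_space "distr M borel (W N (Suc 0))" by (rule prob_space_distr) simp
  interpret D': prob_space "distr M borel (D 0)" by (rule prob_space_distr) simp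
  interpret P: pair_sigma_finite "distr M borel (D 0)" "distr M borel (W N (Suc 0))" ..
  have "(\<integral>\<^sup>+\<omega>. f (W (Suc N) 0 \<omega>) \<partial>M)
      = (\<integral>\<^sup>+p. f (max 0 (snd p - fst p)) \<partial>distr M (borel \<Otimes>\<^sub>M borel) (\<lambda>\<omega>. (D 0 \<omega>, W N (Suc 0) \<omega>)))"
    by (subst nn_integral_distr) auto
  also have "distr M (borel \<Otimes>\<^sub>M borel) (\<lambda>\<omega>. (D 0 \<omega>, W N (Suc 0) \<omega>))
      = distr M borel (D 0) \<Otimes>\<^sub>M distr M borel (W N (Suc 0))"
    using indep_step_W[of 0 N] by (simp add: indep_var_distribution_eq)
  also have "(\<integral>\<^sup>+p. f (max 0 (snd p - fst p)) \<partial>\<dots>)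
      = (\<integral>\<^sup>+w. (\<integral>\<^sup>+d. f (max 0 (w - d)) \<partial>distr M borel (D 0)) \<partial>distr M borel (W N (Suc 0)))"
    by (subst P.nn_integral_snd[symmetric]) (auto cong: measurable_cong_sets)
  also have "\<dots> = (\<integral>\<^sup>+w. (\<integral>\<^sup>+\<omega>'. f (max 0 (w - D 0 \<omega>')) \<partial>M) \<partial>distr M borel (W N (Suc 0)))"
    by (subst nn_integral_distr) auto
  also have "\<dots> = (\<integral>\<^sup>+\<omega>. (\<integral>\<^sup>+\<omega>'. f (max 0 (W N (Suc 0) \<omega> - D 0 \<omega>')) \<partial>M) \<partial>M)"
    by (subst nn_integral_distr) auto
  also have "\<dots> = (\<integral>\<^sup>+\<omega>. (\<integral>\<^sup>+\<omega>'. f (max 0 (W N 0 \<omega> - D 0 \<omega>')) \<partial>M) \<partial>M)"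
    by (rule nn_integral_W_cong) simp
  finally show ?thesis .
qed

section \<open>Drift conditions and tail probabilities\<close>

lemma drift_sum_bound:
  fixes V :: "real \<Rightarrow> real" and \<kappa> m y :: real
  assumes [measurable]: "V \<in> borel_measurable borel"
    and V: "\<And>w. 0 \<le> w \<Longrightarrow> 0 \<le> V w" and \<kappa>: "0 \<le> \<kappa>" and m: "0 \<le> m"
    and drift: "\<And>w. 0 \<le> w \<Longrightarrow> (\<integral>\<^sup>+\<omega>. ennreal (V (max 0 (w - D 0 \<omega>))) \<partial>M)
        + ennreal (\<kappa> * indicator {y<..} w) \<le> ennreal (V w + m)"
  shows "(\<integral>\<^sup>+\<omega>. ennreal (V (W N 0 \<omega>)) \<partial>M) + ennreal (\<kappa> * (\<Sum>i<N. prob {\<omega>\<in>space M. y < W i 0 \<omega>}))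
      \<le> ennreal (V 0 + N * m)"
proof (induction N)
  case (Suc N)
  let ?p = "\<lambda>i. prob {\<omega>\<in>space M. y < W i 0 \<omega>}"
  have p: "ennreal (\<kappa> * ?p N) = (\<integral>\<^sup>+\<omega>. ennreal (\<kappa> * indicator {y<..} (W N 0 \<omega>)) \<partial>M)"
  proof -
    have "(\<integral>\<^sup>+\<omega>. ennreal (\<kappa> * indicator {y<..} (W N 0 \<omega>)) \<partial>M)
        = (\<integral>\<^sup>+\<omega>. ennreal \<kappa> * indicator {\<omega>\<in>space M. y < W N 0 \<omega>} \<omega> \<partial>M)"
      using \<kappa> by (intro nn_integral_cong) (auto simp: indicator_def)
    also have "\<dots> = ennreal \<kappa> * emeasure M {\<omega>\<in>space M. y < W N 0 \<omega>}"
      by (rule nn_integral_cmult_indicator) measurable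
    finally show ?thesis
      using \<kappa> by (simp add: emeasure_eq_measure ennreal_mult')
  qed
  \<comment> \<open>The drift inequality is integrated over the law of the current state
    \<open>W N 0\<close>. Extended integrals make this valid before \<open>V\<close> of the state is
    known to be integrable.\<close>
  have "(\<integral>\<^sup>+\<omega>. ennreal (V (W (Suc N) 0 \<omega>)) \<partial>M) + ennreal (\<kappa> * ?p N)
      = (\<integral>\<^sup>+\<omega>. (\<integral>\<^sup>+\<omega>'. ennreal (V (max 0 (W N 0 \<omega> - D 0 \<omega>'))) \<partial>M)
            + ennreal (\<kappa> * indicator {y<..} (W N 0 \<omega>)) \<partial>M)"
    unfolding p by (subst nn_integral_W_Suc[of "\<lambda>w. ennreal (V w)"]) (simp_all add: nn_integral_add)
  also have "\<dots> \<le> (\<integral>\<^sup>+\<omega>. ennreal (V (W N 0 \<omega>) + m) \<partial>M)"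
    by (intro nn_integral_mono drift drawdown_nonneg)
  also have "\<dots> = (\<integral>\<^sup>+\<omega>. ennreal (V (W N 0 \<omega>)) + ennreal m \<partial>M)"
    using m by (intro nn_integral_cong ennreal_plus V drawdown_nonneg) auto
  also have "\<dots> = (\<integral>\<^sup>+\<omega>. ennreal (V (W N 0 \<omega>)) \<partial>M) + ennreal m"
    by (subst nn_integral_add) (auto simp: emeasure_space_1)
  finally have step: "(\<integral>\<^sup>+\<omega>. ennreal (V (W (Suc N) 0 \<omega>)) \<partial>M) + ennreal (\<kappa> * ?p N)
      \<le> (\<integral>\<^sup>+\<omega>. ennreal (V (W N 0 \<omega>)) \<partial>M) + ennreal m" .
  have "(\<integral>\<^sup>+\<omega>. ennreal (V (W (Suc N) 0 \<omega>)) \<partial>M) + ennreal (\<kappa> * (\<Sum>i<Suc N. ?p i))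
      = ((\<integral>\<^sup>+\<omega>. ennreal (V (W (Suc N) 0 \<omega>)) \<partial>M) + ennreal (\<kappa> * ?p N)) + ennreal (\<kappa> * (\<Sum>i<N. ?p i))"
    using \<kappa> by (simp add: distrib_left sum_nonneg add_ac del: drawdown.simps)
  also have "\<dots> \<le> ((\<integral>\<^sup>+\<omega>. ennreal (V (W N 0 \<omega>)) \<partial>M) + ennreal (\<kappa> * (\<Sum>i<N. ?p i))) + ennreal m"
    using add_right_mono[OF step, of "ennreal (\<kappa> * (\<Sum>i<N. ?p i))"] by (simp only: add_ac)
  also have "\<dots> \<le> ennreal (V 0 + N * m) + ennreal m"
    by (intro add_right_mono Suc)
  also have "\<dots> = ennreal (V 0 + Suc N * m)"
    using m V[of 0] by (subst ennreal_plus[symmetric]) (auto simp: algebra_simps)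
  finally show ?case .
qed (use V[of 0] in \<open>simp add: emeasure_space_1\<close>)

text \<open>The tail probabilities increase with the horizon, so in the summed drift inequality up
  to \<open>N + L\<close> the last \<open>L\<close> terms are each at least the \<open>N\<close>-th
  one. Dividing by \<open>L\<close> and letting it grow removes \<open>V 0\<close> and
  \<open>N * m\<close>.\<close>

lemma drift_tail_bound:
  fixes V :: "real \<Rightarrow> real" and \<kappa> m y :: real
  assumes [measurable]: "V \<in> borel_measurable borel"
    and V: "\<And>w. 0 \<le> w \<Longrightarrow> 0 \<le> V w" and \<kappa>: "0 \<le> \<kappa>" and m: "0 \<le> m"
    and drift: "\<And>w. 0 \<le> w \<Longrightarrow> (\<integral>\<^sup>+\<omega>. ennreal (V (max 0 (w - D 0 \<omega>))) \<partial>M)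
        + ennreal (\<kappa> * indicator {y<..} w) \<le> ennreal (V w + m)"
  shows "\<kappa> * prob {\<omega>\<in>space M. y < W N n \<omega>} \<le> m"
proof -
  let ?p = "\<lambda>i. prob {\<omega>\<in>space M. y < W i 0 \<omega>}"
  have eq: "prob {\<omega>\<in>space M. y < W N n \<omega>} = ?p N"
  proof -
    have "measure (distr M borel (W N n)) {y<..} = measure (distr M borel (W N 0)) {y<..}"
      by (simp only: distr_W[of N n])
    then show ?thesis
      by (subst (asm) (1 2) measure_distr) (auto simp: vimage_def Int_def conj_commute)
  qed
  have bound: "\<kappa> * (real L * ?p N) \<le> V 0 + real (N + L) * m" for L
  proof -
    have "(\<Sum>i\<in>{N..<N+L}. ?p N) \<le> (\<Sum>i\<in>{N..<N+L}. ?p i)"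
      by (intro sum_mono finite_measure_mono) (auto intro: less_le_trans drawdown_mono)
    also have "\<dots> \<le> (\<Sum>i<N+L. ?p i)"
      by (intro sum_mono2) auto
    finally have "\<kappa> * (real L * ?p N) \<le> \<kappa> * (\<Sum>i<N+L. ?p i)"
      using \<kappa> by (intro mult_left_mono) auto
    moreover have "ennreal (\<kappa> * (\<Sum>i<N+L. ?p i)) \<le> ennreal (V 0 + real (N + L) * m)"
      using order_trans[OF add_increasing[OF zero_le order_refl]
        drift_sum_bound[OF assms(1) V \<kappa> m drift, of "N + L"]] by simp
    ultimately show ?thesis
      using V[of 0] m by (subst (asm) ennreal_le_iff) auto
  qed
  have "(\<lambda>L. (V 0 + real N * m) / real L + m) \<longlonglongrightarrow> 0 + m"
    by (intro tendsto_add tendsto_const lim_const_over_n)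
  moreover have "\<forall>\<^sub>F L in sequentially. \<kappa> * ?p N \<le> (V 0 + real N * m) / real L + m"
    using eventually_gt_at_top[of 0]
  proof eventually_elim
    case (elim L)
    then show ?case using bound[of L] by (simp add: field_simps)
  qed
  ultimately have "\<kappa> * ?p N \<le> 0 + m"
    by (intro tendsto_lowerbound[of _ _ sequentially]) auto
  then show ?thesis by (simp add: eq)
qed

section \<open>Almost sure escape above every level, by second moments\<close>

lemma second_moment_sum:
  assumes sq: "integrable M (\<lambda>\<omega>. (D 0 \<omega>)\<^sup>2)"
  defines "\<mu> \<equiv> expectation (D 0)"
  shows "integrable M (\<lambda>\<omega>. (\<Sum>k<n. D k \<omega> - \<mu>)\<^sup>2)"
    and "expectation (\<lambda>\<omega>. (\<Sum>k<n. D k \<omega> - \<mu>)\<^sup>2) = n * variance (D 0)"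
proof -
  define X where "X k \<omega> = D k \<omega> - \<mu>" for k \<omega>
  define v where "v = variance (D 0)"
  have int: "integrable M (\<lambda>\<omega>. f (D k \<omega>)) \<longleftrightarrow> integrable M (\<lambda>\<omega>. f (D 0 \<omega>))"
    and ex: "expectation (\<lambda>\<omega>. f (D k \<omega>)) = expectation (\<lambda>\<omega>. f (D 0 \<omega>))"
    if [measurable]: "f \<in> borel_measurable borel" for f :: "real \<Rightarrow> real" and k
    using integrable_distr_eq[of "D k" M borel f] integrable_distr_eq[of "D 0" M borel f]
      integral_distr[of "D k" M borel f] integral_distr[of "D 0" M borel f] ident[of k] by simp_all
  have D0: "integrable M (D 0)"
    by (rule square_integrable_imp_integrable[OF _ sq]) simp
  have X0: "integrable M (X 0)" "expectation (X 0) = 0" "integrable M (\<lambda>\<omega>. (X 0 \<omega>)\<^sup>2)"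
    using D0 sq by (auto simp: X_def[abs_def] \<mu>_def prob_space power2_diff)
  have X: "integrable M (X k)" "expectation (X k) = 0" "integrable M (\<lambda>\<omega>. (X k \<omega>)\<^sup>2)"
      "expectation (\<lambda>\<omega>. (X k \<omega>)\<^sup>2) = v" for k
    using int[of "\<lambda>x. x - \<mu>" k] int[of "\<lambda>x. (x - \<mu>)\<^sup>2" k] ex[of "\<lambda>x. x - \<mu>" k] ex[of "\<lambda>x. (x - \<mu>)\<^sup>2" k] X0
    by (auto simp: X_def[abs_def] v_def \<mu>_def)
  have indX: "indep_vars (\<lambda>_. borel) X UNIV"
    unfolding X_def[abs_def] by (rule indep_vars_compose2[OF indep]) simp
  have "integrable M (\<lambda>\<omega>. (\<Sum>k<n. X k \<omega>)\<^sup>2) \<and> expectation (\<lambda>\<omega>. (\<Sum>k<n. X k \<omega>)\<^sup>2) = n * v"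
  proof (induction n)
    case (Suc n)
    \<comment> \<open>The next centred step is independent of the partial sum, so the cross term in
      the square is integrable with mean zero.\<close>
    have "indep_var borel (X n) borel (\<lambda>\<omega>. \<Sum>k<n. X k \<omega>)"
      by (rule indep_vars_sum) (auto intro: indep_vars_subset[OF indX])
    moreover have "integrable M (\<lambda>\<omega>. \<Sum>k<n. X k \<omega>)"
      using X by auto
    ultimately have "integrable M (\<lambda>\<omega>. X n \<omega> * (\<Sum>k<n. X k \<omega>))"
      "expectation (\<lambda>\<omega>. X n \<omega> * (\<Sum>k<n. X k \<omega>)) = 0"
      using X[of n] indep_var_integrable[of "X n" "\<lambda>\<omega>. \<Sum>k<n. X k \<omega>"]
        indep_var_lebesgue_integral[of "X n" "\<lambda>\<omega>. \<Sum>k<n. X k \<omega>"] by auto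
    moreover have "(\<Sum>k<Suc n. X k \<omega>)\<^sup>2 = (X n \<omega>)\<^sup>2 + 2 * (X n \<omega> * (\<Sum>k<n. X k \<omega>)) + (\<Sum>k<n. X k \<omega>)\<^sup>2" for \<omega>
      by (simp add: power2_eq_square algebra_simps)
    ultimately show ?case
      using Suc X[of n] by (simp add: algebra_simps)
  qed (simp add: X_def)
  then show "integrable M (\<lambda>\<omega>. (\<Sum>k<n. D k \<omega> - \<mu>)\<^sup>2)"
    and "expectation (\<lambda>\<omega>. (\<Sum>k<n. D k \<omega> - \<mu>)\<^sup>2) = n * variance (D 0)"
    by (auto simp: X_def v_def)
qed

text \<open>Chebyshev at each time \<open>n\<close> with \<open>n * m > x\<close>: staying below
  \<open>x\<close> forever forces a deviation of at least \<open>n * m - x\<close> from the mean.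
  The bound is of order 1/n, while the event does not depend on \<open>n\<close>.\<close>

lemma AE_walk_exceeds:
  assumes sq: "integrable M (\<lambda>\<omega>. (D 0 \<omega>)\<^sup>2)" and \<mu>: "expectation (D 0) > 0"
  shows "AE \<omega> in M. \<exists>n. x < (\<Sum>k<n. D k \<omega>)"
proof -
  define m v where "m = expectation (D 0)" and "v = variance (D 0)"
  define E where "E = {\<omega>\<in>space M. \<forall>n. (\<Sum>k<n. D k \<omega>) \<le> x}"
  have [measurable]: "E \<in> events" by (simp add: E_def)
  have "prob E \<le> real n * v / (real n * m - x)\<^sup>2" if n: "real n * m > x" for n
  proof -
    have "prob E \<le> prob {\<omega>\<in>space M. (real n * m - x)\<^sup>2 \<le> (\<Sum>k<n. D k \<omega> - m)\<^sup>2}"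
    proof (rule finite_measure_mono)
      show "E \<subseteq> {\<omega>\<in>space M. (real n * m - x)\<^sup>2 \<le> (\<Sum>k<n. D k \<omega> - m)\<^sup>2}"
      proof
        fix \<omega> assume "\<omega> \<in> E"
        then have "\<omega> \<in> space M" and le: "(\<Sum>k<n. D k \<omega>) \<le> x" by (auto simp: E_def)
        have "(real n * m - x)\<^sup>2 \<le> (real n * m - (\<Sum>k<n. D k \<omega>))\<^sup>2"
          using n le by (intro power_mono) auto
        then show "\<omega> \<in> {\<omega>\<in>space M. (real n * m - x)\<^sup>2 \<le> (\<Sum>k<n. D k \<omega> - m)\<^sup>2}"
          using \<open>\<omega> \<in> space M\<close> by (simp add: sum_subtractf power2_commute)
      qed
    qed measurable
    also have "\<dots> \<le> expectation (\<lambda>\<omega>. (\<Sum>k<n. D k \<omega> - m)\<^sup>2) / (real n * m - x)\<^sup>2"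
      using second_moment_sum(1)[OF sq, of n] n
      by (intro integral_Markov_inequality_measure[where A = "{}"]) (auto simp: m_def)
    also have "\<dots> = real n * v / (real n * m - x)\<^sup>2"
      using second_moment_sum(2)[OF sq, of n] by (simp add: m_def v_def)
    finally show ?thesis .
  qed
  moreover have "\<forall>\<^sub>F n in sequentially. real n * m > x"
    using \<mu> unfolding m_def[symmetric] by real_asymp
  ultimately have "\<forall>\<^sub>F n in sequentially. prob E \<le> real n * v / (real n * m - x)\<^sup>2"
    by (auto elim: eventually_mono)
  moreover have "(\<lambda>n. real n * v / (real n * m - x)\<^sup>2) \<longlonglongrightarrow> 0"
    using \<mu> unfolding m_def[symmetric] by real_asymp
  ultimately have "prob E \<le> 0"
    by (intro tendsto_lowerbound[of _ 0 sequentially]) auto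
  then have "prob E = 0"
    using measure_nonneg[of M E] by linarith
  then have "AE \<omega> in M. \<omega> \<notin> E"
    by (intro AE_not_in) (simp add: null_sets_def emeasure_eq_measure)
  then show ?thesis
    by (rule AE_mp) (auto simp: E_def not_le intro!: AE_I2)
qed

section \<open>Ruin after a passage above the upper barrier\<close>

lemma ruin_after_exceeding_le:
  fixes z y K :: real
  defines "Z \<equiv> \<lambda>n \<omega>. z + (\<Sum>k<n. D k \<omega>)"
  assumes K: "\<And>N n. prob {\<omega>\<in>space M. y < W N n \<omega>} \<le> K"
  shows "prob {\<omega>\<in>space M. (\<exists>n. Z n \<omega> < 0) \<and> (\<exists>n. y < Z n \<omega> \<and> (\<forall>k\<le>n. 0 \<le> Z k \<omega>))} \<le> K"
proof -
  \<comment> \<open>First passage above \<open>y\<close> at time \<open>n\<close>, with no ruin so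
    far. These events are disjoint and depend on the first \<open>n\<close> steps only.\<close>
  define B where "B n = {\<omega>\<in>space M. y < Z n \<omega> \<and> (\<forall>k<n. Z k \<omega> \<le> y) \<and> (\<forall>k\<le>n. 0 \<le> Z k \<omega>)}" for n
  \<comment> \<open>One index bounds both the passage time and the later horizon, which makes
    \<open>F\<close> increasing.\<close>
  define F where "F N = (\<Union>n<N. B n \<inter> {\<omega>\<in>space M. y < W N n \<omega>})" for N
  have [measurable]: "Z n \<in> borel_measurable M" for n by (simp add: Z_def)
  have [measurable]: "B n \<in> events" for n by (simp add: B_def)
  have [measurable]: "F N \<in> events" for N by (simp add: F_def)
  have disj: "disjoint_family_on B {..<N}" for N
  proof -
    have "B i \<inter> B j = {}" if "i < j" for i j
      using that by (auto simp: B_def not_less)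
    then show ?thesis
      by (auto simp: disjoint_family_on_def) (metis disjoint_iff linorder_neqE_nat)
  qed
  have prod: "prob (B n \<inter> {\<omega>\<in>space M. y < W N n \<omega>}) = prob (B n) * prob {\<omega>\<in>space M. y < W N n \<omega>}" for n N
  proof -
    \<comment> \<open>Copies on sequences indexed below \<open>n\<close>: they exhibit
      \<open>B n\<close> as an event of the past of time \<open>n\<close>, hence independent of
      \<open>W N n\<close>.\<close>
    define Z' where "Z' k x = z + (\<Sum>i<k. x i)" for k and x :: "nat \<Rightarrow> real"
    define B' where "B' = {x\<in>space (PiM {..<n} (\<lambda>_. borel)). y < Z' n x \<and> (\<forall>k<n. Z' k x \<le> y) \<and> (\<forall>k\<le>n. 0 \<le> Z' k x)}"
    have Z'[measurable]: "Z' k \<in> borel_measurable (PiM {..<n} (\<lambda>_. borel))" if "k \<le> n" for k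
      unfolding Z'_def using that
      by (intro borel_measurable_add borel_measurable_const borel_measurable_sum measurable_component_singleton) auto
    have B'[measurable]: "B' \<in> sets (PiM {..<n} (\<lambda>_. borel))"
      unfolding B'_def by measurable
    have Z'_eq: "Z' k (restrict (\<lambda>k. D k \<omega>) {..<n}) = Z k \<omega>" if "k \<le> n" for k \<omega>
      using that by (auto simp: Z'_def Z_def intro!: sum.cong)
    define f :: "(nat \<Rightarrow> real) \<Rightarrow> real" where "f = indicator B'"
    let ?f = "\<lambda>\<omega>. f (restrict (\<lambda>k. D k \<omega>) {..<n})"
    have "f \<in> borel_measurable (PiM {..<n} (\<lambda>_. borel))"
      by (simp add: f_def)
    then have "indep_var borel ?f borel (W N n)"
      by (intro indep_past_W) auto
    then have "prob ((\<lambda>\<omega>. (?f \<omega>, W N n \<omega>)) -` ({1} \<times> {y<..}) \<inter> space M)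
        = prob (?f -` {1} \<inter> space M) * prob (W N n -` {y<..} \<inter> space M)"
      by (rule indep_varD) auto
    moreover have f: "?f -` {1} \<inter> space M = B n"
      by (auto simp: f_def indicator_eq_1_iff B'_def B_def Z'_eq space_PiM)
    moreover have W: "W N n -` {y<..} \<inter> space M = {\<omega>\<in>space M. y < W N n \<omega>}" by auto
    moreover have "(\<lambda>\<omega>. (?f \<omega>, W N n \<omega>)) -` ({1} \<times> {y<..}) \<inter> space M
        = B n \<inter> {\<omega>\<in>space M. y < W N n \<omega>}" unfolding f[symmetric] by auto
    ultimately show ?thesis by simp
  qed
  have "K \<ge> 0" using K[of 0 0] measure_nonneg order_trans by blast
  have F_le: "prob (F N) \<le> K" for N
  proof -
    have "prob (F N) \<le> (\<Sum>n<N. prob (B n \<inter> {\<omega>\<in>space M. y < W N n \<omega>}))"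
      unfolding F_def by (intro finite_measure_subadditive_finite) auto
    \<comment> \<open>The bound \<open>K\<close> is uniform in starting time and horizon, so it
      factors out and the disjoint passage events sum to at most 1.\<close>
    also have "\<dots> \<le> (\<Sum>n<N. prob (B n) * K)"
      unfolding prod by (intro sum_mono mult_left_mono K) auto
    also have "\<dots> = prob (\<Union>n<N. B n) * K"
      by (subst finite_measure_finite_Union[OF _ _ disj]) (auto simp: sum_distrib_right)
    also have "\<dots> \<le> 1 * K"
      using \<open>K \<ge> 0\<close> by (intro mult_right_mono) auto
    finally show ?thesis by simp
  qed
  have "incseq F"
    unfolding F_def by (intro incseq_SucI UN_mono) (auto simp del: drawdown.simps intro: less_le_trans drawdown_le_Suc)
  then have "(\<lambda>N. prob (F N)) \<longlonglongrightarrow> prob (\<Union>N. F N)"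
    by (intro finite_Lim_measure_incseq) auto
  then have lim: "prob (\<Union>N. F N) \<le> K"
    by (rule tendsto_upperbound) (auto simp: F_le)
  have "{\<omega>\<in>space M. (\<exists>n. Z n \<omega> < 0) \<and> (\<exists>n. y < Z n \<omega> \<and> (\<forall>k\<le>n. 0 \<le> Z k \<omega>))} \<subseteq> (\<Union>N. F N)"
  proof safe
    fix \<omega> j n'
    assume \<omega>: "\<omega> \<in> space M" and j: "Z j \<omega> < 0" and n': "y < Z n' \<omega>" "\<forall>k\<le>n'. 0 \<le> Z k \<omega>"
    define n where "n = (LEAST n. y < Z n \<omega>)"
    have n: "y < Z n \<omega>" "n \<le> n'"
      using n'(1) unfolding n_def by (auto intro: LeastI Least_le)
    have least: "Z k \<omega> \<le> y" if "k < n" for k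
      using not_less_Least[of k "\<lambda>n. y < Z n \<omega>"] that by (auto simp: n_def not_less)
    have B: "\<omega> \<in> B n"
      using n least n' \<omega> by (auto simp: B_def)
    \<comment> \<open>Up to \<open>n'\<close>, hence up to the first passage \<open>n\<close>, the
      walk is nonnegative, so ruin at \<open>j\<close> comes later and requires a loss of more than
      \<open>y\<close> from time \<open>n\<close> on.\<close>
    have "n < j"
      using j n n'(2) by (metis le_trans linorder_not_le not_le)
    then have "(\<Sum>k<j. D k \<omega>) = (\<Sum>k<n. D k \<omega>) + (\<Sum>k=n..<j. D k \<omega>)"
      by (metis atLeast0LessThan less_imp_le sum.atLeastLessThan_concat zero_le)
    then have "Z j \<omega> = Z n \<omega> + (\<Sum>k=n..<j. D k \<omega>)"
      by (simp add: Z_def)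
    then have "y < - (\<Sum>k=n..<n+(j-n). D k \<omega>)"
      using j n \<open>n < j\<close> by simp
    also have "\<dots> \<le> W (j - n) n \<omega>" by (rule neg_sum_le_drawdown)
    \<comment> \<open>\<open>Suc j\<close> exceeds both the passage time \<open>n\<close> and the
      horizon \<open>j - n\<close>.\<close>
    also have "\<dots> \<le> W (Suc j) n \<omega>" by (rule drawdown_mono) auto
    finally have "\<omega> \<in> F (Suc j)"
      using B \<omega> \<open>n < j\<close> unfolding F_def by (auto simp del: drawdown.simps)
    then show "\<omega> \<in> (\<Union>N. F N)" by blast
  qed
  then have "prob {\<omega>\<in>space M. (\<exists>n. Z n \<omega> < 0) \<and> (\<exists>n. y < Z n \<omega> \<and> (\<forall>k\<le>n. 0 \<le> Z k \<omega>))} \<le> prob (\<Union>N. F N)"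
    by (intro finite_measure_mono) auto
  with lim show ?thesis by linarith
qed

text \<open>A path that is never negative almost surely exceeds \<open>y\<close>, and then does so
  before ruin. Hence \<open>A \<union> B\<close> has probability 1, and inclusion-exclusion
  identifies the difference as the probability of \<open>A \<inter> B\<close>.\<close>

lemma two_barrier_approximation:
  fixes z y K :: real
  defines "Z \<equiv> \<lambda>n \<omega>. z + (\<Sum>k<n. D k \<omega>)"
  assumes sq: "integrable M (\<lambda>\<omega>. (D 0 \<omega>)\<^sup>2)" and \<mu>: "expectation (D 0) > 0"
    and K: "\<And>N n. prob {\<omega>\<in>space M. y < W N n \<omega>} \<le> K"
  shows "\<bar>prob {\<omega>\<in>space M. \<exists>n. Z n \<omega> < 0}
    - (1 - prob {\<omega>\<in>space M. \<exists>n. y < Z n \<omega> \<and> (\<forall>k\<le>n. 0 \<le> Z k \<omega>)})\<bar> \<le> K"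
proof -
  define A where "A = {\<omega>\<in>space M. \<exists>n. Z n \<omega> < 0}"
  define B where "B = {\<omega>\<in>space M. \<exists>n. y < Z n \<omega> \<and> (\<forall>k\<le>n. 0 \<le> Z k \<omega>)}"
  have [measurable]: "Z n \<in> borel_measurable M" for n by (simp add: Z_def)
  have [measurable]: "A \<in> events" "B \<in> events" by (simp_all add: A_def B_def)
  have "AE \<omega> in M. \<omega> \<in> A \<union> B"
    using AE_walk_exceeds[OF sq \<mu>, of "y - z"]
    by (rule AE_mp) (auto simp: A_def B_def Z_def algebra_simps not_less intro!: AE_I2)
  then have "prob (A \<union> B) = 1" by (intro prob_eq_1[THEN iffD2]) auto
  moreover have "prob (A \<union> B) = prob A + prob (B - A)"
    using finite_measure_Union'[of A B] by auto
  moreover have "prob (B - A) = prob B - prob (A \<inter> B)"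
    using finite_measure_Diff'[of B A] by (auto simp: Int_commute)
  moreover have "prob (A \<inter> B) \<le> K"
  proof -
    have "A \<inter> B = {\<omega>\<in>space M. (\<exists>n. Z n \<omega> < 0) \<and> (\<exists>n. y < Z n \<omega> \<and> (\<forall>k\<le>n. 0 \<le> Z k \<omega>))}"
      by (auto simp: A_def B_def)
    then show ?thesis using ruin_after_exceeding_le[OF K, of z] by (simp add: Z_def)
  qed
  ultimately show ?thesis
    using measure_nonneg[of M "A \<inter> B"] unfolding A_def[symmetric] B_def[symmetric] by linarith
qed

end

subsection \<open>Tail bounds from Lyapunov functions\<close>

text \<open>An integrable majorant \<open>h w\<close> of the next value of \<open>V\<close> lets the
  drift be computed with ordinary expectations. It may hold almost everywhere only, as does the sign
  condition on gains and claims.\<close>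

lemma (in iid_steps) majorant_tail_bound:
  fixes V :: "real \<Rightarrow> real" and \<kappa> m y :: real and h :: "real \<Rightarrow> 'a \<Rightarrow> real"
  assumes V_meas: "V \<in> borel_measurable borel"
    and V: "\<And>w. 0 \<le> w \<Longrightarrow> 0 \<le> V w" and \<kappa>: "0 \<le> \<kappa>" and m: "0 \<le> m"
    and h: "\<And>w. 0 \<le> w \<Longrightarrow> integrable M (h w)"
      "\<And>w. 0 \<le> w \<Longrightarrow> AE \<omega> in M. V (max 0 (w - D 0 \<omega>)) \<le> h w \<omega>"
      "\<And>w. 0 \<le> w \<Longrightarrow> expectation (h w) + \<kappa> * indicator {y<..} w \<le> V w + m"
  shows "\<kappa> * prob {\<omega>\<in>space M. y < W N n \<omega>} \<le> m"
proof (rule drift_tail_bound[OF V_meas V \<kappa> m])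
  fix w :: real assume w: "0 \<le> w"
  have nonneg: "AE \<omega> in M. 0 \<le> h w \<omega>"
    using h(2)[OF w] by eventually_elim (rule order_trans[OF V], auto)
  have "(\<integral>\<^sup>+\<omega>. ennreal (V (max 0 (w - D 0 \<omega>))) \<partial>M) \<le> (\<integral>\<^sup>+\<omega>. ennreal (h w \<omega>) \<partial>M)"
    using h(2)[OF w] by (intro nn_integral_mono_AE) (auto elim!: eventually_mono intro: ennreal_leI)
  also have "\<dots> = ennreal (expectation (h w))"
    by (rule nn_integral_eq_integral[OF h(1)[OF w] nonneg])
  finally have "(\<integral>\<^sup>+\<omega>. ennreal (V (max 0 (w - D 0 \<omega>))) \<partial>M) + ennreal (\<kappa> * indicator {y<..} w)
      \<le> ennreal (expectation (h w)) + ennreal (\<kappa> * indicator {y<..} w)"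
    by (rule add_right_mono)
  also have "\<dots> = ennreal (expectation (h w) + \<kappa> * indicator {y<..} w)"
    using integral_nonneg_AE[OF nonneg] \<kappa> by (subst ennreal_plus) auto
  also have "\<dots> \<le> ennreal (V w + m)"
    by (intro ennreal_leI h(3) w)
  finally show "(\<integral>\<^sup>+\<omega>. ennreal (V (max 0 (w - D 0 \<omega>))) \<partial>M) + ennreal (\<kappa> * indicator {y<..} w) \<le> ennreal (V w + m)" .
qed auto

text \<open>From any state the mean rises by at most that of the negative part of the step. From a
  state above \<open>y\<close> a gain up to \<open>y\<close> is fully effective; the factor
  \<open>y / s\<close> compares truncation at \<open>y\<close> with truncation at the larger level
  \<open>s\<close>, where the mean is controlled.\<close>

lemma (in iid_steps) linear_tail_bound:
  assumes int: "integrable M (D 0)" and y: "0 < y" "y \<le> s"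
    and r: "0 \<le> r" "r \<le> expectation (\<lambda>\<omega>. min (D 0 \<omega>) s)"
  shows "(y / s * r) * prob {\<omega>\<in>space M. y < W N n \<omega>} \<le> expectation (\<lambda>\<omega>. max 0 (- D 0 \<omega>))"
proof -
  define i :: "real \<Rightarrow> real" where "i = indicator {y<..}"
  define h where "h w \<omega> = w - i w * (y / s * min (D 0 \<omega>) s) + max 0 (- D 0 \<omega>)" for w \<omega>
  have [simp]: "integrable M (\<lambda>\<omega>. min (D 0 \<omega>) s)" "integrable M (\<lambda>\<omega>. max 0 (- D 0 \<omega>))"
    using int by auto
  show ?thesis
  proof (rule majorant_tail_bound[where V = "\<lambda>w. w" and h = h])
    fix w :: real assume w: "0 \<le> w"
    show "integrable M (h w)"
      unfolding h_def[abs_def] by (intro Bochner_Integration.integrable_add Bochner_Integration.integrable_diff integrable_mult_right) auto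
    \<comment> \<open>For positive \<open>d\<close> this is concavity of \<open>min d\<close> as a
      function of the level; otherwise the left-hand side is at most 0.\<close>
    have trunc: "y / s * min d s \<le> min (max 0 d) y" for d
    proof (cases "d \<le> 0")
      case True
      then show ?thesis using y by (auto simp: min_def max_def divide_le_0_iff mult_le_0_iff)
    next
      case False
      have "y / s * min d s \<le> 1 * min d s" using y False by (intro mult_right_mono) auto
      moreover have "y / s * min d s \<le> y / s * s" using y by (intro mult_left_mono) auto
      ultimately show ?thesis using y False by auto
    qed
    have "max 0 (w - D 0 \<omega>) \<le> h w \<omega>" for \<omega>
      using trunc[of "D 0 \<omega>"] w y by (auto simp: h_def i_def indicator_def)
    then show "AE \<omega> in M. max 0 (w - D 0 \<omega>) \<le> h w \<omega>" by simp
    have "expectation (h w) = w - i w * (y / s * expectation (\<lambda>\<omega>. min (D 0 \<omega>) s)) + expectation (\<lambda>\<omega>. max 0 (- D 0 \<omega>))"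
      unfolding h_def by (simp add: prob_space)
    moreover have "i w * (y / s * r) \<le> i w * (y / s * expectation (\<lambda>\<omega>. min (D 0 \<omega>) s))"
      using y r by (intro mult_left_mono) (auto simp: i_def)
    ultimately show "expectation (h w) + (y / s * r) * indicator {y<..} w \<le> w + expectation (\<lambda>\<omega>. max 0 (- D 0 \<omega>))"
      by (simp add: i_def mult.commute)
  qed (use y r in \<open>auto intro!: Bochner_Integration.integral_nonneg\<close>)
qed

text \<open>Drift of \<open>w powr \<gamma>\<close>, with the crude majorant below \<open>s\<close>
  and the second-order one from \<open>s\<close> on. The function \<open>q\<close> is
  \<open>c powr (\<gamma> - 2)\<close> with the convention that 0 to the power 0 is 1.\<close>

lemma (in iid_steps) powr_tail_bound:
  fixes g c :: "'a \<Rightarrow> real" and \<gamma> a s\<^sub>1 s m y :: real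
  defines "q \<equiv> \<lambda>\<omega>. if \<gamma> = 2 then 1 else c \<omega> powr (\<gamma> - 2)"
  assumes D0: "\<And>\<omega>. D 0 \<omega> = g \<omega> - c \<omega>"
    and nonneg: "AE \<omega> in M. 0 \<le> g \<omega> \<and> 0 \<le> c \<omega>"
    and \<gamma>: "2 \<le> \<gamma>" and a: "0 < a" and s\<^sub>1: "0 < s\<^sub>1" "s\<^sub>1 \<le> s" and y: "s \<le> y"
    and int: "integrable M (D 0)" "integrable M (\<lambda>\<omega>. (D 0 \<omega>)\<^sup>2)"
      "integrable M (\<lambda>\<omega>. q \<omega> * (D 0 \<omega>)\<^sup>2)" "integrable M (\<lambda>\<omega>. (s + c \<omega>) powr (\<gamma> - 1) * c \<omega>)"
    and trunc: "2 / 3 * a \<le> expectation (\<lambda>\<omega>. min (D 0 \<omega>) s\<^sub>1)"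
    and s: "2 powr (\<gamma> - 1) * (\<gamma> - 1) / a * expectation (\<lambda>\<omega>. (D 0 \<omega>)\<^sup>2) \<le> s"
    and m: "\<gamma> * (\<gamma> - 1) * 2 powr (\<gamma> - 3) * expectation (\<lambda>\<omega>. q \<omega> * (D 0 \<omega>)\<^sup>2) \<le> m"
      "\<gamma> * expectation (\<lambda>\<omega>. (s + c \<omega>) powr (\<gamma> - 1) * c \<omega>) \<le> m"
  shows "(a * \<gamma> / 3 * y powr (\<gamma> - 1)) * prob {\<omega>\<in>space M. y < W N n \<omega>} \<le> m"
proof -
  define k where "k = \<gamma> * (\<gamma> - 1) * 2 powr (\<gamma> - 3)"
  define v where "v = expectation (\<lambda>\<omega>. (D 0 \<omega>)\<^sup>2)"
  define above where "above w \<omega> = w powr \<gamma> - \<gamma> * w powr (\<gamma> - 1) * min (D 0 \<omega>) s\<^sub>1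
    + k * w powr (\<gamma> - 2) * (D 0 \<omega>)\<^sup>2 + k * (q \<omega> * (D 0 \<omega>)\<^sup>2)" for w \<omega>
  define below where "below w \<omega> = w powr \<gamma> + \<gamma> * ((s + c \<omega>) powr (\<gamma> - 1) * c \<omega>)" for w \<omega>
  have [simp]: "integrable M (\<lambda>\<omega>. min (D 0 \<omega>) s\<^sub>1)" using int by auto
  have v: "2 powr (\<gamma> - 3) * 4 * (\<gamma> - 1) * v \<le> a * s"
  proof -
    have "2 powr (\<gamma> - 1) = 2 powr (\<gamma> - 3) * 4"
      using powr_add[of 2 "\<gamma> - 3" 2] by simp
    with s a show ?thesis by (simp add: v_def field_simps)
  qed
  show ?thesis
  proof (rule majorant_tail_bound[where V = "\<lambda>w. w powr \<gamma>" and h = "\<lambda>w. if w < s then below w else above w"])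
    show "0 \<le> m"
      using \<gamma> m(1) by (rule_tac order_trans[OF _ m(1)]) (auto simp: q_def intro!: mult_nonneg_nonneg Bochner_Integration.integral_nonneg)
    fix w :: real assume w: "0 \<le> w"
    show "integrable M (if w < s then below w else above w)"
    proof -
      have "integrable M (below w)" "integrable M (above w)"
        unfolding below_def[abs_def] above_def[abs_def] using int by auto
      then show ?thesis by simp
    qed
    show "AE \<omega> in M. max 0 (w - D 0 \<omega>) powr \<gamma> \<le> (if w < s then below w else above w) \<omega>"
      using nonneg
    proof eventually_elim
      case (elim \<omega>)
      \<comment> \<open>The second-order bound is used with truncation level
        \<open>s\<^sub>1 \<le> s \<le> w\<close>, the level at which the truncated mean is
        controlled.\<close>
      show ?case
        using powr_step_below[of \<gamma> w s "g \<omega>" "c \<omega>"] powr_step_above[of \<gamma> s\<^sub>1 w "g \<omega>" "c \<omega>"] elim w \<gamma> s\<^sub>1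
        by (auto simp: below_def above_def D0 k_def q_def)
    qed
    show "expectation (if w < s then below w else above w) + (a * \<gamma> / 3 * y powr (\<gamma> - 1)) * indicator {y<..} w \<le> w powr \<gamma> + m"
    proof (cases "w < s")
      case True
      have "expectation (below w) = w powr \<gamma> + \<gamma> * expectation (\<lambda>\<omega>. (s + c \<omega>) powr (\<gamma> - 1) * c \<omega>)"
        unfolding below_def using int by (simp add: prob_space)
      \<comment> \<open>The indicator vanishes, since \<open>w < s \<le> y\<close>.\<close>
      then show ?thesis using True m(2) y by simp
    next
      case False
      then have w: "s \<le> w" "0 < w" using s\<^sub>1 by auto
      have w1: "w powr (\<gamma> - 1) = w powr (\<gamma> - 2) * w"
        using w powr_add[of w "\<gamma> - 2" 1] by simp
      have ex: "expectation (above w) = w powr \<gamma> - \<gamma> * w powr (\<gamma> - 1) * expectation (\<lambda>\<omega>. min (D 0 \<omega>) s\<^sub>1)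
          + k * w powr (\<gamma> - 2) * v + k * expectation (\<lambda>\<omega>. q \<omega> * (D 0 \<omega>)\<^sup>2)"
        unfolding above_def v_def using int by (simp add: prob_space)
      have "\<gamma> * w powr (\<gamma> - 1) * (2 / 3 * a) \<le> \<gamma> * w powr (\<gamma> - 1) * expectation (\<lambda>\<omega>. min (D 0 \<omega>) s\<^sub>1)"
        using \<gamma> trunc by (intro mult_left_mono) auto
      \<comment> \<open>The lower bound on \<open>s\<close> is designed for this: the quadratic term
        costs at most a/4 of the drift 2a/3, and 2/3 - 1/4 > 1/3.\<close>
      moreover have "k * w powr (\<gamma> - 2) * v \<le> \<gamma> * w powr (\<gamma> - 1) * (a / 4)"
      proof -
        have "a * s \<le> a * w" using a w by simp
        with v have "\<gamma> * w powr (\<gamma> - 2) / 4 * (2 powr (\<gamma> - 3) * 4 * (\<gamma> - 1) * v) \<le> \<gamma> * w powr (\<gamma> - 2) / 4 * (a * w)"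
          using \<gamma> by (intro mult_left_mono) auto
        then show ?thesis by (simp add: k_def w1 algebra_simps)
      qed
      moreover have "(a * \<gamma> / 3 * y powr (\<gamma> - 1)) * indicator {y<..} w \<le> a * \<gamma> / 3 * w powr (\<gamma> - 1)"
        using a \<gamma> y s\<^sub>1 by (auto simp: indicator_def intro!: mult_left_mono powr_mono2)
      moreover have "0 \<le> a * \<gamma> * w powr (\<gamma> - 1)" using a \<gamma> by simp
      ultimately show ?thesis
        using False ex m(1)[folded k_def] by (simp add: algebra_simps)
    qed
  qed (use a \<gamma> in auto)
qed

subsection \<open>The two-barrier probability\<close>

text \<open>Passes from the extended constants of the theorem to real expectations;
  \<open>k > 0\<close> keeps an infinite integral from hiding behind a zero factor.\<close>

lemma integrable_of_nn_integral_bound: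
  fixes f :: "'a \<Rightarrow> real"
  assumes [measurable]: "f \<in> borel_measurable M" and f: "AE x in M. 0 \<le> f x"
    and k: "0 < k" "0 \<le> m" and le: "ennreal k * (\<integral>\<^sup>+x. ennreal (f x) \<partial>M) \<le> ennreal m"
  shows "integrable M f" "k * (\<integral>x. f x \<partial>M) \<le> m"
proof -
  have "(\<integral>\<^sup>+x. ennreal (f x) \<partial>M) < \<infinity>"
  proof (rule ccontr)
    assume "\<not> (\<integral>\<^sup>+x. ennreal (f x) \<partial>M) < \<infinity>"
    then have "(\<integral>\<^sup>+x. ennreal (f x) \<partial>M) = \<top>" by (metis infinity_ennreal_def top.not_eq_extremum)
    with le k show False by (simp add: ennreal_mult_top top_unique)
  qed
  then show int: "integrable M f" by (intro integrableI_nonneg f) auto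
  have "ennreal (k * (\<integral>x. f x \<partial>M)) \<le> ennreal m"
    using le k by (simp add: nn_integral_eq_integral[OF int f] ennreal_mult')
  then show "k * (\<integral>x. f x \<partial>M) \<le> m"
    using k by simp
qed

lemma less_hit_time_iff: "enat n < hit_time S X \<longleftrightarrow> (\<forall>k\<le>n. X k \<notin> S)"
proof (cases "\<exists>k. X k \<in> S")
  case True
  then have "X (LEAST k. X k \<in> S) \<in> S" by (rule LeastI_ex)
  then show ?thesis
    using True by (simp add: hit_time_def) (metis le_less_trans not_le not_less_Least)
qed (auto simp: hit_time_def)

text \<open>Replaces the comparison of hitting times by quantifiers over times, the form in which
  the event is measurable and is treated for the walk.\<close>

lemma hits_first_iff:
  "hit_time S X < hit_time T X \<and> hit_time S X < \<infinity> \<longleftrightarrow> (\<exists>n. X n \<in> S \<and> (\<forall>k\<le>n. X k \<notin> T))"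
proof
  assume *: "hit_time S X < hit_time T X \<and> hit_time S X < \<infinity>"
  then have ex: "\<exists>n. X n \<in> S" by (auto simp: hit_time_def split: if_splits)
  then have "hit_time S X = enat (LEAST n. X n \<in> S)" by (simp add: hit_time_def)
  with * LeastI_ex[OF ex] show "\<exists>n. X n \<in> S \<and> (\<forall>k\<le>n. X k \<notin> T)"
    by (auto simp: less_hit_time_iff)
next
  assume "\<exists>n. X n \<in> S \<and> (\<forall>k\<le>n. X k \<notin> T)"
  then obtain n where n: "X n \<in> S" "enat n < hit_time T X" by (auto simp: less_hit_time_iff)
  have "hit_time S X \<le> enat n"
    using n(1) less_hit_time_iff[of n S X] by (auto simp: not_less[symmetric])
  with n(2) show "hit_time S X < hit_time T X \<and> hit_time S X < \<infinity>"
    by (meson enat_ord_code(4) le_less_trans)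
qed

theorem theorem2:
  fixes M :: "'a measure" and G C :: "nat \<Rightarrow> 'a \<Rightarrow> real"
    and \<gamma> s1 z y :: real
  assumes "prob_space M"
    and indep: "prob_space.indep_vars M (\<lambda>_. borel) (\<lambda>n \<omega>. (G n \<omega>, C n \<omega>)) UNIV"
    and ident: "\<And>n. distr M borel (\<lambda>\<omega>. (G n \<omega>, C n \<omega>)) = distr M borel (\<lambda>\<omega>. (G 0 \<omega>, C 0 \<omega>))"
    and nonneg: "\<And>n. AE \<omega> in M. G n \<omega> \<ge> 0 \<and> C n \<omega> \<ge> 0"
    and intG: "integrable M (G 0)" and intC: "integrable M (C 0)"
    and a_pos: "(\<integral>\<omega>. G 0 \<omega> \<partial>M) - (\<integral>\<omega>. C 0 \<omega> \<partial>M) > 0"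
    and FC: "\<And>x. x > 0 \<Longrightarrow> cdf (distr M borel (C 0)) x < 1"
    and gamma: "\<gamma> \<ge> 2"
    and mom: "integrable M (\<lambda>\<omega>. \<bar>C 0 \<omega> - G 0 \<omega>\<bar> powr \<gamma>)"
    and s1: "(\<integral>\<omega>. min (G 0 \<omega> - C 0 \<omega>) s1 \<partial>M)
               \<ge> 2/3 * ((\<integral>\<omega>. G 0 \<omega> \<partial>M) - (\<integral>\<omega>. C 0 \<omega> \<partial>M))"
    and "z > 0" and "y > 0"
  shows
    "let a = (\<integral>\<omega>. G 0 \<omega> \<partial>M) - (\<integral>\<omega>. C 0 \<omega> \<partial>M);
         s2 = 2 powr (\<gamma> - 1) * (\<gamma> - 1) / a * (\<integral>\<omega>. (G 0 \<omega> - C 0 \<omega>)^2 \<partial>M);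
         s3 = max s1 s2;
         c1 = ennreal (\<gamma> * (\<gamma> - 1) * 2 powr (\<gamma> - 3)) *
              (\<integral>\<^sup>+\<omega>. ennreal ((if \<gamma> = 2 then 1 else C 0 \<omega> powr (\<gamma> - 2)) * (G 0 \<omega> - C 0 \<omega>)^2) \<partial>M);
         c2 = ennreal \<gamma> * (\<integral>\<^sup>+\<omega>. ennreal ((s3 + C 0 \<omega>) powr (\<gamma> - 1) * C 0 \<omega>) \<partial>M);
         c = ennreal 3 * max c1 c2 / ennreal (a * \<gamma>) + ennreal (1/2 * s3 powr (\<gamma> - 1));
         \<psi> = measure M {\<omega> \<in> space M. \<exists>n. CL_proc G C z \<omega> n < 0};
         \<phi> = measure M {\<omega> \<in> space M.
                hit_time {y<..} (CL_proc G C z \<omega>) < hit_time {..<0} (CL_proc G C z \<omega>) \<and>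
                hit_time {y<..} (CL_proc G C z \<omega>) < \<infinity>}
     in ennreal \<bar>\<psi> - (1 - \<phi>)\<bar> \<le> c * ennreal (y powr (1 - \<gamma>))"
proof -
  interpret prob_space M by fact
  define a where "a = (\<integral>\<omega>. G 0 \<omega> \<partial>M) - (\<integral>\<omega>. C 0 \<omega> \<partial>M)"
  define s2 where "s2 = 2 powr (\<gamma> - 1) * (\<gamma> - 1) / a * (\<integral>\<omega>. (G 0 \<omega> - C 0 \<omega>)^2 \<partial>M)"
  define s3 where "s3 = max s1 s2"
  define c1 where "c1 = ennreal (\<gamma> * (\<gamma> - 1) * 2 powr (\<gamma> - 3)) *
              (\<integral>\<^sup>+\<omega>. ennreal ((if \<gamma> = 2 then 1 else C 0 \<omega> powr (\<gamma> - 2)) * (G 0 \<omega> - C 0 \<omega>)^2) \<partial>M)"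
  define c2 where "c2 = ennreal \<gamma> * (\<integral>\<^sup>+\<omega>. ennreal ((s3 + C 0 \<omega>) powr (\<gamma> - 1) * C 0 \<omega>) \<partial>M)"
  define c where "c = ennreal 3 * max c1 c2 / ennreal (a * \<gamma>) + ennreal (1/2 * s3 powr (\<gamma> - 1))"
  define \<psi> where "\<psi> = prob {\<omega> \<in> space M. \<exists>n. CL_proc G C z \<omega> n < 0}"
  define \<phi> where "\<phi> = prob {\<omega> \<in> space M.
                hit_time {y<..} (CL_proc G C z \<omega>) < hit_time {..<0} (CL_proc G C z \<omega>) \<and>
                hit_time {y<..} (CL_proc G C z \<omega>) < \<infinity>}"
  define D where "D n \<omega> = G n \<omega> - C n \<omega>" for n \<omega>
  have [measurable]: "G 0 \<in> borel_measurable M" "C 0 \<in> borel_measurable M"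
    using intG intC by auto
  have a: "a > 0" using a_pos by (simp add: a_def)
  have diff_meas [measurable]: "(\<lambda>p. fst p - snd p) \<in> borel_measurable (borel :: (real \<times> real) measure)"
    by (intro borel_measurable_continuous_onI continuous_intros)
  interpret iid_steps M D
  proof
    show "indep_vars (\<lambda>_. borel) D UNIV"
      using indep_vars_compose2[OF indep, of "\<lambda>_ p. fst p - snd p" "\<lambda>_. borel"] diff_meas
      by (simp add: D_def[abs_def])
    have *: "distr M borel (D n) = distr (distr M borel (\<lambda>\<omega>. (G n \<omega>, C n \<omega>))) borel (\<lambda>p. fst p - snd p)" for n
    proof -
      have "(\<lambda>\<omega>. (G n \<omega>, C n \<omega>)) \<in> borel_measurable M"
        using indep by (auto simp: indep_vars_def)
      then show ?thesis
        by (subst distr_distr[OF diff_meas]) (auto simp: D_def[abs_def] comp_def)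
    qed
    show "distr M borel (D n) = distr M borel (D 0)" for n
      by (simp only: * ident[of n])
  qed
  have D0: "integrable M (D 0)" "expectation (D 0) = a"
    using intG intC by (auto simp: D_def[abs_def] a_def)
  have sq: "integrable M (\<lambda>\<omega>. (D 0 \<omega>)\<^sup>2)"
  proof (rule Bochner_Integration.integrable_bound[where f = "\<lambda>\<omega>. 1 + \<bar>C 0 \<omega> - G 0 \<omega>\<bar> powr \<gamma>"])
    have "x\<^sup>2 \<le> 1 + \<bar>x\<bar> powr \<gamma>" for x :: real
    proof (cases "\<bar>x\<bar> \<le> 1")
      case True
      then have "x\<^sup>2 \<le> 1" by (simp add: abs_square_le_1)
      then show ?thesis by (simp add: add_increasing2)
    next
      case False
      then have "\<bar>x\<bar> powr 2 \<le> \<bar>x\<bar> powr \<gamma>" using gamma by (intro powr_mono) auto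
      then show ?thesis using False by simp
    qed
    from this[of "C 0 _ - G 0 _"]
    show "AE \<omega> in M. norm ((D 0 \<omega>)\<^sup>2) \<le> norm (1 + \<bar>C 0 \<omega> - G 0 \<omega>\<bar> powr \<gamma>)"
      by (auto simp: D_def power2_commute[of "G 0 _"])
  qed (use mom in auto)
  have s1_trunc: "2 / 3 * a \<le> expectation (\<lambda>\<omega>. min (D 0 \<omega>) s1)"
    using s1 by (simp add: D_def a_def)
  have trunc_mono: "expectation (\<lambda>\<omega>. min (D 0 \<omega>) s) \<le> expectation (\<lambda>\<omega>. min (D 0 \<omega>) t)" if "s \<le> t" for s t
    using D0(1) that by (intro integral_mono) auto
  have s1_pos: "s1 > 0"
  \<comment> \<open>A nonpositive truncation level would make the truncated mean nonpositive,
    against 2a/3 > 0.\<close>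
  proof (rule ccontr)
    assume "\<not> s1 > 0"
    then have "expectation (\<lambda>\<omega>. min (D 0 \<omega>) s1) \<le> expectation (\<lambda>\<omega>. 0)"
      using D0(1) by (intro integral_mono) auto
    with s1_trunc a show False by simp
  qed
  have s3: "s1 \<le> s3" "s2 \<le> s3" "s3 > 0" using s1_pos by (auto simp: s3_def)
  have "ennreal \<bar>\<psi> - (1 - \<phi>)\<bar> \<le> c * ennreal (y powr (1 - \<gamma>))"
  \<comment> \<open>Only the difference has a finite moment of order \<gamma>, so the constants can
    be infinite, for instance for \<open>G = C + 1\<close> with heavy-tailed \<open>C\<close>. The
    bound is then trivial because \<open>y powr (1 - \<gamma>)\<close> is positive.\<close>
  proof (cases "max c1 c2 = \<top>")
    case True
    then have "c = \<top>"
      by (simp add: c_def ennreal_mult_top ennreal_top_divide)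
    then show ?thesis using \<open>y > 0\<close> by (simp add: ennreal_top_mult)
  next
    case False
    then obtain m where m: "0 \<le> m" "max c1 c2 = ennreal m"
      by (cases "max c1 c2") auto
    then have "c1 \<le> ennreal m" "c2 \<le> ennreal m" by (metis max.cobounded1, metis max.cobounded2)
    define q where "q \<omega> = (if \<gamma> = 2 then 1 else C 0 \<omega> powr (\<gamma> - 2))" for \<omega>
    define e2 where "e2 \<omega> = (s3 + C 0 \<omega>) powr (\<gamma> - 1) * C 0 \<omega>" for \<omega>
    have [measurable]: "q \<in> borel_measurable M" "e2 \<in> borel_measurable M"
      by (simp_all add: q_def[abs_def] e2_def[abs_def])
    have k: "0 < \<gamma> * (\<gamma> - 1) * 2 powr (\<gamma> - 3)" using gamma by simp
    have m1: "integrable M (\<lambda>\<omega>. q \<omega> * (D 0 \<omega>)\<^sup>2)"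
        "\<gamma> * (\<gamma> - 1) * 2 powr (\<gamma> - 3) * expectation (\<lambda>\<omega>. q \<omega> * (D 0 \<omega>)\<^sup>2) \<le> m"
      using integrable_of_nn_integral_bound[OF _ _ k m(1), of "\<lambda>\<omega>. q \<omega> * (D 0 \<omega>)\<^sup>2" M] \<open>c1 \<le> ennreal m\<close>
      by (auto simp: c1_def q_def[abs_def] D_def[abs_def])
    have "AE \<omega> in M. 0 \<le> e2 \<omega>"
      using nonneg[of 0] by eventually_elim (auto simp: e2_def)
    then have m2: "integrable M e2" "\<gamma> * expectation e2 \<le> m"
      using integrable_of_nn_integral_bound[of e2 M \<gamma> m] gamma m(1) \<open>c2 \<le> ennreal m\<close>
      by (auto simp: c2_def e2_def[abs_def])
    define K where "K = 3 * m / (a * \<gamma>) * y powr (1 - \<gamma>)"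
    have inv: "y powr (1 - \<gamma>) = 1 / y powr (\<gamma> - 1)"
      using powr_minus_divide[of y "\<gamma> - 1"] by simp
    have K: "prob {\<omega>\<in>space M. y < W N n \<omega>} \<le> K" for N n
    proof (cases "s3 \<le> y")
      case True
      have "(a * \<gamma> / 3 * y powr (\<gamma> - 1)) * prob {\<omega>\<in>space M. y < W N n \<omega>} \<le> m"
        using m1 m2
        by (intro powr_tail_bound[where g = "G 0" and c = "C 0" and s\<^sub>1 = s1 and s = s3])
          (use nonneg[of 0] gamma a s1_pos s3 True D0 sq s1_trunc in
            \<open>auto simp: D_def[abs_def] q_def[abs_def] e2_def[abs_def] s2_def\<close>)
      then show ?thesis
        using a gamma \<open>y > 0\<close> by (simp add: K_def inv field_simps)
    next
      case False
      let ?p = "prob {\<omega>\<in>space M. y < W N n \<omega>}"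
      define e where "e = expectation (C 0)"
      \<comment> \<open>Enlarging the truncation level from \<open>s1\<close> to \<open>s3\<close>
        only increases the truncated mean. The negative part of \<open>D 0\<close> is at most
        \<open>C 0\<close> because gains are nonnegative.\<close>
      have "y / s3 * (2 / 3 * a) * ?p \<le> expectation (\<lambda>\<omega>. max 0 (- D 0 \<omega>))"
        using False a \<open>y > 0\<close> D0 s1_trunc trunc_mono[OF s3(1)] by (intro linear_tail_bound) auto
      also have "\<dots> \<le> e"
        unfolding e_def using intG intC nonneg[of 0]
        by (intro integral_mono_AE) (auto simp: D_def elim!: eventually_mono)
      finally have p: "y / s3 * (2 / 3 * a) * ?p \<le> e" .
      have "s3 powr (\<gamma> - 1) * e = expectation (\<lambda>\<omega>. s3 powr (\<gamma> - 1) * C 0 \<omega>)"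
        by (simp add: e_def)
      also have "\<dots> \<le> expectation e2"
      proof (rule integral_mono_AE)
        show "AE \<omega> in M. s3 powr (\<gamma> - 1) * C 0 \<omega> \<le> e2 \<omega>"
          using nonneg[of 0]
        proof eventually_elim
          case (elim \<omega>)
          then show ?case
            using s3 gamma unfolding e2_def by (intro mult_right_mono powr_mono2) auto
        qed
      qed (use intC m2(1) in auto)
      finally have "\<gamma> * (s3 powr (\<gamma> - 1) * e) \<le> \<gamma> * expectation e2"
        using gamma by (intro mult_left_mono) auto
      with m2(2) have e: "\<gamma> * (s3 powr (\<gamma> - 1) * e) \<le> m" by linarith
      \<comment> \<open>As \<open>y < s3\<close> and \<gamma> \<ge> 2, the linear factor
        \<open>y / s3\<close> dominates its power of order \<gamma> - 1, which turns the linear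
        bound into one of the required order.\<close>
      have "y powr (\<gamma> - 2) \<le> s3 powr (\<gamma> - 2)"
        using False \<open>y > 0\<close> gamma by (intro powr_mono2) auto
      moreover have "s3 powr (\<gamma> - 1) = s3 powr (\<gamma> - 2) * s3" "y powr (\<gamma> - 1) = y powr (\<gamma> - 2) * y"
        using powr_add[of s3 "\<gamma> - 2" 1] powr_add[of y "\<gamma> - 2" 1] s3 \<open>y > 0\<close> by auto
      ultimately have "\<gamma> * (2 / 3 * a * y powr (\<gamma> - 1)) * ?p \<le> \<gamma> * (2 / 3 * a * (s3 powr (\<gamma> - 2) * y)) * ?p"
        using gamma a \<open>y > 0\<close> by (intro mult_right_mono mult_left_mono) auto
      also have "\<dots> = \<gamma> * s3 powr (\<gamma> - 1) * (y / s3 * (2 / 3 * a) * ?p)"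
        using s3 \<open>s3 powr (\<gamma> - 1) = s3 powr (\<gamma> - 2) * s3\<close> by (simp add: field_simps)
      also have "\<dots> \<le> \<gamma> * s3 powr (\<gamma> - 1) * e"
        using p gamma by (intro mult_left_mono) auto
      \<comment> \<open>The coefficient on the left is twice the a\<gamma>/3 implicit in
        \<open>K\<close>, hence \<open>2 * m\<close> on the right.\<close>
      finally have "\<gamma> * (2 / 3 * a * y powr (\<gamma> - 1)) * ?p \<le> 2 * m"
        using e m(1) by (simp add: mult.assoc)
      then show ?thesis
        using a gamma \<open>y > 0\<close> by (simp add: K_def inv field_simps)
    qed
    have "\<psi> = prob {\<omega>\<in>space M. \<exists>n. z + (\<Sum>k<n. D k \<omega>) < 0}"
      by (simp add: \<psi>_def CL_proc_def D_def)
    moreover have "\<phi> = prob {\<omega>\<in>space M. \<exists>n. y < z + (\<Sum>k<n. D k \<omega>) \<and> (\<forall>k\<le>n. 0 \<le> z + (\<Sum>i<k. D i \<omega>))}"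
      unfolding \<phi>_def hits_first_iff by (simp add: CL_proc_def D_def not_less)
    ultimately have "\<bar>\<psi> - (1 - \<phi>)\<bar> \<le> K"
      using two_barrier_approximation[OF sq _ K, of z] D0 a by simp
    then have "ennreal \<bar>\<psi> - (1 - \<phi>)\<bar> \<le> ennreal K"
      by (rule ennreal_leI)
    also have "\<dots> = ennreal (3 * m / (a * \<gamma>)) * ennreal (y powr (1 - \<gamma>))"
      unfolding K_def using m a gamma by (intro ennreal_mult) auto
    also have "\<dots> \<le> c * ennreal (y powr (1 - \<gamma>))"
    proof (rule mult_right_mono)
      have "ennreal (3 * m / (a * \<gamma>)) = ennreal 3 * max c1 c2 / ennreal (a * \<gamma>)"
        using m a gamma by (simp add: divide_ennreal[symmetric] ennreal_mult)
      then show "ennreal (3 * m / (a * \<gamma>)) \<le> c"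
        by (simp add: c_def)
    qed auto
    finally show ?thesis .
  qed
  then show ?thesis
    unfolding Let_def c_def c1_def c2_def s3_def s2_def a_def \<psi>_def \<phi>_def .
qed

end
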